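(* Let $\pi\subset\mathbb{R}^2$ be a bounded region of the plane and let $\mathrm{rb}\,E$ be a planar ribbon contained in the interior of $\pi$. Then $\mathrm{rb}\,E$ divides $\pi$ into three disjoint bounded regions.
   Context: A filled cycle $\mathrm{cyc}\,A$ is the part of the plane consisting of a simple closed curve (containing a finite, nonempty, path-connected collection of vertices of a planar CW space) together with everything inside it; $\mathrm{cl}$, $\mathrm{int}$, $\mathrm{bdy}$ denote closure, interior, boundary. Given filled cycles $\mathrm{cyc}\,A,\mathrm{cyc}\,B$ with $\mathrm{cyc}\,B$ contained entirely in the interior of $\mathrm{cyc}\,A$, the associated planar ribbon is $\mathrm{rb}\,E=\mathrm{cl}(\mathrm{cyc}\,A)\setminus\mathrm{int}(\mathrm{cyc}\,B)$: it contains both boundary curves and excludes the interior of the inner cycle. That the ribbon divides $\pi$ into three disjoint bounded regions means that $\pi$ is the union of the following three sets, which are pairwise disjoint and bounded: the part of $\pi$ outside the ribbon and its inner cycle, $\pi\setminus\mathrm{cl}(\mathrm{cyc}\,A)$; the ribbon minus its closed inner cycle, $\mathrm{cl}(\mathrm{rb}\,E)\setminus\mathrm{cl}(\mathrm{cyc}\,B)$; and the closed inner cycle $\mathrm{cl}(\mathrm{cyc}\,B)$.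
   Formalization: It is additionally assumed that no hole of π (bounded component of its complement) meets the inner filled cycle cyc B; otherwise the claim fails, e.g. for an annulus π whose ribbon surrounds the hole, and the condition is necessary for the conclusion. *)

theory Defs
  imports "HOL-Analysis.Analysis"
begin

text \<open>
  A CW decomposition of a subset of the plane. Cells are given as open cells; by invariance of
  domain a subset of the plane has no cells of dimension greater than 2.
\<close>

record planar_cells =
  vertices :: "(real^2) set"
  edges :: "(real^2) set set"
  faces :: "(real^2) set set"

definition cells :: "planar_cells \<Rightarrow> (real^2) set set" where
  "cells K = (\<lambda>v. {v}) ` vertices K \<union> edges K \<union> faces K"

definition one_skeleton :: "planar_cells \<Rightarrow> (real^2) set" where
  "one_skeleton K = vertices K \<union> \<Union> (edges K)"

text \<open>
  The dimension of the cell is that of the type \<open>'a\<close>; for \<open>'a = real\<close> the sphere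
  is the pair of end points \<open>{-1, 1}\<close>.
\<close>

definition characteristic_map ::
    "('a::euclidean_space \<Rightarrow> real^2) \<Rightarrow> (real^2) set \<Rightarrow> (real^2) set \<Rightarrow> bool" where
  "characteristic_map \<phi> e L \<longleftrightarrow>
     continuous_on (cball 0 1) \<phi> \<and>
     (\<exists>\<psi>. homeomorphism (ball 0 1) e \<phi> \<psi>) \<and>
     \<phi> ` sphere 0 1 \<subseteq> L"

text \<open>
  The third condition is closure finiteness (automatic for edges), the fourth is disjointness of
  distinct cells, the last is the weak topology. The Hausdorff property is inherited from the
  plane, and the image of a closed ball under the characteristic map of a cell \<open>e\<close> is
  \<open>closure e\<close>.
\<close>

definition planar_CW :: "planar_cells \<Rightarrow> bool" where
  "planar_CW K \<longleftrightarrow>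
     (\<forall>e\<in>edges K. \<exists>\<phi>::real \<Rightarrow> real^2. characteristic_map \<phi> e (vertices K)) \<and>
     (\<forall>f\<in>faces K. \<exists>\<phi>::real^2 \<Rightarrow> real^2. characteristic_map \<phi> f (one_skeleton K)) \<and>
     (\<forall>f\<in>faces K. \<exists>V E. finite V \<and> V \<subseteq> vertices K \<and> finite E \<and> E \<subseteq> edges K \<and>
        closure f \<subseteq> f \<union> V \<union> \<Union>E) \<and>
     pairwise disjnt (cells K) \<and>
     (\<forall>S \<subseteq> \<Union> (cells K). (\<forall>c\<in>cells K. closed (S \<inter> closure c)) \<longrightarrow>
        closedin (top_of_set (\<Union> (cells K))) S)"

definition path_connected_vertices :: "planar_cells \<Rightarrow> (real^2) set \<Rightarrow> bool" where
  "path_connected_vertices K V \<longleftrightarrow>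
     V \<subseteq> vertices K \<and> (\<forall>v\<in>V. \<forall>w\<in>V. path_component (one_skeleton K) v w)"

definition filled_cycle :: "(real^2) set \<Rightarrow> bool" where
  "filled_cycle A \<longleftrightarrow>
     (\<exists>K V \<gamma>. planar_CW K \<and> path_connected_vertices K V \<and> finite V \<and> V \<noteq> {} \<and>
        simple_path \<gamma> \<and> pathfinish \<gamma> = pathstart \<gamma> \<and> V \<subseteq> path_image \<gamma> \<and>
        A = path_image \<gamma> \<union> inside (path_image \<gamma>))"

definition planar_ribbon :: "(real^2) set \<Rightarrow> (real^2) set \<Rightarrow> (real^2) set \<Rightarrow> bool" where
  "planar_ribbon A B E \<longleftrightarrow>
     filled_cycle A \<and> filled_cycle B \<and> B \<subseteq> interior A \<and> E = closure A - interior B"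

definition divides_into_three_bounded ::
    "(real^2) set \<Rightarrow> (real^2) set \<Rightarrow> (real^2) set \<Rightarrow> (real^2) set \<Rightarrow> bool" where
  "divides_into_three_bounded S R1 R2 R3 \<longleftrightarrow>
     S = R1 \<union> R2 \<union> R3 \<and>
     disjnt R1 R2 \<and> disjnt R1 R3 \<and> disjnt R2 R3 \<and>
     bounded R1 \<and> bounded R2 \<and> bounded R3"

text \<open>
  A ribbon in the interior of a bounded set \<open>S\<close> may surround a hole of \<open>S\<close> (let
  \<open>S\<close> be an annulus); then the closed inner cycle is not part of \<open>S\<close> and the ribbon does
  not divide \<open>S\<close> in the above sense. Holes of \<open>S\<close>, i.e. bounded components of the
  complement, make up \<open>inside S\<close>. The condition below holds for every \<open>S\<close> without holes,
  but also permits holes outside the inner cycle \<open>B\<close>.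
\<close>

definition no_hole_within :: "(real^2) set \<Rightarrow> (real^2) set \<Rightarrow> bool" where
  "no_hole_within S B \<longleftrightarrow> inside S \<inter> B = {}"

end

theory Submission
  imports Defs
begin

text \<open>
  The only point that is not immediate is that \<open>closure B\<close> lies in \<open>\<pi>\<close>. The frontier of
  \<open>B\<close> lies in the ribbon, hence in \<open>\<pi>\<close>; a point of \<open>B\<close> outside \<open>\<pi>\<close> would lie in an
  unbounded component of the complement of \<open>\<pi>\<close>, which would have to cross that frontier.
\<close>

lemma filled_cycle_closed: "filled_cycle A \<Longrightarrow> closed A"
  unfolding filled_cycle_def by (auto intro: closed_path_image_Un_inside simple_path_imp_path)

lemma filled_cycle_bounded: "filled_cycle A \<Longrightarrow> bounded A"
  unfolding filled_cycle_def
  by (auto dest!: bounded_simple_path_image intro: bounded_inside)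

lemma subset_if_frontier_subset_if_inside_disjoint:
  fixes B S :: "'a::real_normed_vector set"
  assumes "bounded B" "frontier B \<subseteq> S" "inside S \<inter> B = {}"
  shows "B \<subseteq> S"
proof
  fix x assume "x \<in> B"
  show "x \<in> S"
  proof (rule ccontr)
    assume "x \<notin> S"
    let ?C = "connected_component_set (- S) x"
    \<comment> \<open>\<open>inside S\<close> collects the points off \<open>S\<close> whose
      component in \<open>- S\<close> is bounded; \<open>x\<close> lies off \<open>S\<close> but,
      being in \<open>B\<close>, not in \<open>inside S\<close>.\<close>
    have "\<not> bounded ?C"
      using \<open>x \<in> B\<close> \<open>x \<notin> S\<close> assms(3) by (auto simp: inside_def)
    then have "?C - B \<noteq> {}"
      using assms(1) bounded_subset by blast
    moreover have "x \<in> ?C \<inter> B"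
      using \<open>x \<in> B\<close> \<open>x \<notin> S\<close> by simp
    ultimately have "?C \<inter> frontier B \<noteq> {}"
      using connected_Int_frontier[of ?C B] by blast
    then show False
      using assms(2) connected_component_subset[of "- S" x] by blast
  qed
qed

theorem theorem8:
  fixes \<pi> A B E :: "(real^2) set"
  assumes "bounded \<pi>"
    and "planar_ribbon A B E"
    and "E \<subseteq> interior \<pi>"
    and "no_hole_within \<pi> B"
  shows "divides_into_three_bounded \<pi> (\<pi> - closure A) (closure E - closure B) (closure B)"
proof -
  have A: "closed A" "bounded A" and B: "closed B" "bounded B"
    and BA: "B \<subseteq> A" and E: "E = A - interior B"
    using assms(2) filled_cycle_closed filled_cycle_bounded interior_subset
    unfolding planar_ribbon_def by (fastforce simp: closure_closed)+
  have "closed E"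
    using A(1) E by (simp add: closed_Diff)
  have "E \<subseteq> \<pi>"
    using assms(3) interior_subset by blast
  \<comment> \<open>As \<open>B\<close> is closed, its frontier is \<open>B - interior B\<close>,
    and \<open>B\<close> lies in \<open>A\<close>.\<close>
  have "frontier B \<subseteq> E"
    using B(1) BA E by (auto simp: frontier_def closure_closed)
  then have "B \<subseteq> \<pi>"
    using subset_if_frontier_subset_if_inside_disjoint[OF B(2)] \<open>E \<subseteq> \<pi>\<close> assms(4)
    unfolding no_hole_within_def by blast
  moreover have "bounded (E - B)" "bounded (\<pi> - A)"
    using A(2) E assms(1) by (auto intro: bounded_subset)
  \<comment> \<open>A point of \<open>A\<close> outside \<open>B\<close> is also outside
    \<open>interior B\<close>, hence in \<open>E\<close>.\<close>
  moreover have "\<pi> = (\<pi> - A) \<union> (E - B) \<union> B"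
    using \<open>B \<subseteq> \<pi>\<close> \<open>E \<subseteq> \<pi>\<close> E interior_subset by blast
  ultimately show ?thesis
    using A(1) B BA E \<open>closed E\<close>
    unfolding divides_into_three_bounded_def disjnt_def
    by (auto simp: closure_closed)
qed

end
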